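(* Let $\boldsymbol{H}\in\mathbb{R}^{M\times N}$ and $\boldsymbol{L}\in\mathbb{R}^{m\times N}$. For any $\tau\ge 0$, let $\epsilon(\tau)=\lambda_{\max}(\boldsymbol{H}^T\boldsymbol{H}-\tau\boldsymbol{L}^T\boldsymbol{L})$. Let $\hat{\boldsymbol{H}}$ and $\hat{\boldsymbol{L}}$ be corresponding estimates (of $\boldsymbol{H}$ and $\boldsymbol{L}$, respectively) of rank $r$ with coefficients $\boldsymbol{C}_L$, and let $\sigma_k$ denote the $k$th largest singular value of $\boldsymbol{L}$. Then $$\|\boldsymbol{H}-\hat{\boldsymbol{H}}\|\le \min_{\tau,\,k\le\mathrm{rank}(\boldsymbol{L})}\rho_k(\tau),$$ $$\rho_k(\tau):=\left(1+\|\boldsymbol{C}_L\|\right)\sqrt{\tau\sigma_{k+1}^2+\epsilon(\tau)}+\|\boldsymbol{L}-\hat{\boldsymbol{L}}\|\sqrt{\tau+\epsilon(\tau)\sigma_k^{-2}},$$ where the minimum is over $\tau\ge 0$ and $k\le\mathrm{rank}(\boldsymbol{L})$. When $k=\mathrm{rank}(\boldsymbol{L})$, $\sigma_{k+1}$ is set to $0$.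
   Context: $\|\cdot\|$ denotes the matrix norm induced by the $\ell_2$ norm (spectral norm), and $\lambda_{\max}(\cdot)$ denotes the largest eigenvalue of a matrix. $\boldsymbol{H}$ and $\boldsymbol{L}$ are high-fidelity and low-fidelity data matrices whose corresponding columns are realizations of a quantity of interest at the same input samples. Corresponding estimates: given $r$ column indices in $\{1,\dots,N\}$, let $\boldsymbol{L}(r)\in\mathbb{R}^{m\times r}$ and $\boldsymbol{H}(r)\in\mathbb{R}^{M\times r}$ be the matrices formed by the columns of $\boldsymbol{L}$ and $\boldsymbol{H}$, respectively, with these indices (same indices, same order). For a coefficient matrix $\boldsymbol{C}_L\in\mathbb{R}^{r\times N}$, the matrices $\hat{\boldsymbol{L}}=\boldsymbol{L}(r)\boldsymbol{C}_L$ and $\hat{\boldsymbol{H}}=\boldsymbol{H}(r)\boldsymbol{C}_L$ are called corresponding estimates of rank $r$ with coefficients $\boldsymbol{C}_L$; they differ only in the basis vectors used. (The typical instance is $\boldsymbol{C}_L=[\,\boldsymbol{I}\mid\boldsymbol{Z}\,]\boldsymbol{P}^T$ from a rank-$r$ interpolative decomposition $\boldsymbol{L}\approx\boldsymbol{L}(r)\boldsymbol{C}_L$, where $\boldsymbol{I}$ is the $r\times r$ identity, $\boldsymbol{Z}$ is an $r\times(N-r)$ matrix, $\boldsymbol{P}$ is an $N\times N$ permutation matrix, and $\boldsymbol{L}(r)$ consists of the first $r$ columns of $\boldsymbol{L}\boldsymbol{P}$.)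
   Formalization: The minimum is taken as an infimum over τ≥0 with ε(τ)≥0 (automatic if rank(L)<N) and 1≤k≤rank(L), and the r column indices are distinct; for ε(τ)<0 or repeated indices the bound can fail or be undefined. *)

theory Defs
  imports "HOL-Analysis.Analysis" "HOL-Library.Multiset"
begin

definition spectral_norm :: "real^'n^'m \<Rightarrow> real" where
  "spectral_norm A = onorm ((*v) A)"

definition is_eigenvalue :: "real^'n^'n \<Rightarrow> real \<Rightarrow> bool" where
  "is_eigenvalue A c \<longleftrightarrow> (\<exists>v. v \<noteq> 0 \<and> A *v v = c *\<^sub>R v)"

text \<open>
  Only real eigenvalues are considered; the constant is used for symmetric matrices,
  for which the set below is finite and nonempty.
\<close>

definition max_eigenvalue :: "real^'n^'n \<Rightarrow> real" where
  "max_eigenvalue A = Max {c. is_eigenvalue A c}"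

text \<open>
  The singular values are the square roots of the eigenvalues of the Gram matrix, each
  repeated as often as the dimension of its eigenspace (which for a symmetric matrix is also
  its algebraic multiplicity).  There are as many of them as columns of the matrix; when there
  are more columns than rows, the list is the usual one padded with zeros.
\<close>

definition singular_values :: "real^'n^'m \<Rightarrow> real multiset" where
  "singular_values A =
     (let G = transpose A ** A
      in \<Sum>c \<in> {c. is_eigenvalue G c}. replicate_mset (dim {v. G *v v = c *\<^sub>R v}) (sqrt c))"

text \<open>
  The \<open>k\<close>th largest singular value, counted from \<open>k = 1\<close>; meaningful for \<open>k\<close> between 1 and
  the number of columns.
\<close>

definition singular_value :: "real^'n^'m \<Rightarrow> nat \<Rightarrow> real" where
  "singular_value A k = rev (sorted_list_of_multiset (singular_values A)) ! (k - 1)"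

definition select_columns :: "real^'n^'m \<Rightarrow> ('r \<Rightarrow> 'n) \<Rightarrow> real^'r^'m" where
  "select_columns A idx = (\<chi> i j. A $ i $ idx j)"

text \<open>
  The rank \<open>r\<close> of the estimates is the cardinality of the index type \<open>'r\<close>.  The selected
  column indices are pairwise distinct.
\<close>

definition corresponding_estimates ::
    "real^'n^'k \<Rightarrow> real^'n^'m \<Rightarrow> real^'n^'r \<Rightarrow> real^'n^'k \<Rightarrow> real^'n^'m \<Rightarrow> bool" where
  "corresponding_estimates H L C Hhat Lhat \<longleftrightarrow>
     (\<exists>idx :: 'r \<Rightarrow> 'n. inj idx \<and>
        Hhat = select_columns H idx ** C \<and> Lhat = select_columns L idx ** C)"

definition eps :: "real^'n^'k \<Rightarrow> real^'n^'m \<Rightarrow> real \<Rightarrow> real" where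
  "eps H L \<tau> = max_eigenvalue (transpose H ** H - \<tau> *\<^sub>R (transpose L ** L))"

text \<open>
  The bound below is valid for \<open>eps H L \<tau> \<ge> 0\<close>, which always holds when \<open>rank L\<close> is less than the
  number of columns.  For negative values it can fail, even if both radicands are nonnegative:
  take \<open>L = diag(3, 2, 1)\<close>, \<open>H = diag(sqrt 8, sqrt 3, 0)\<close>, \<open>\<tau> = 1\<close>, \<open>k = 2\<close>, the third column as the
  only selected one, and \<open>C = (0, 0, 1)\<close>.  Then \<open>eps H L 1 = -1\<close> and the bound is
  \<open>3 * sqrt (3/4)\<close>, but the error is \<open>sqrt 8\<close>.
\<close>

definition rho ::
    "real^'n^'k \<Rightarrow> real^'n^'m \<Rightarrow> real^'n^'r \<Rightarrow> real^'n^'m \<Rightarrow> nat \<Rightarrow> real \<Rightarrow> real" where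
  "rho H L C Lhat k \<tau> =
     (let \<sigma>\<^sub>k = singular_value L k;
          \<sigma>\<^sub>k\<^sub>1 = (if k = rank L then 0 else singular_value L (k + 1))
      in (1 + spectral_norm C) * sqrt (\<tau> * \<sigma>\<^sub>k\<^sub>1\<^sup>2 + eps H L \<tau>)
         + spectral_norm (L - Lhat) * sqrt (\<tau> + eps H L \<tau> * inverse (\<sigma>\<^sub>k\<^sup>2)))"

end

theory Submission
  imports Defs
begin

text \<open>
  Both errors are data matrices applied to one and the same residual.  Taking columns and recombining them
  is a multiplication from the right, so \<open>(H - Hhat) x = H y\<close> and \<open>(L - Lhat) x = L y\<close> with
  \<open>y = x - S C x\<close>, where the selection \<open>S\<close> is an isometry because the selected columns are
  distinct; hence \<open>\<parallel>y\<parallel> \<le> (1 + \<parallel>C\<parallel>) \<parallel>x\<parallel>\<close>.  The number \<open>\<epsilon> = eps H L \<tau>\<close> is the largest value of a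
  Rayleigh quotient, so that \<open>\<parallel>H z\<parallel>\<^sup>2 \<le> \<tau> \<parallel>L z\<parallel>\<^sup>2 + \<epsilon> \<parallel>z\<parallel>\<^sup>2\<close> for every \<open>z\<close>
  (\<open>norm_mult_le_eps\<close>): knowledge of \<open>L z\<close> controls \<open>H z\<close>.

  Now split \<open>y = p + q\<close> by right singular vectors of \<open>L\<close>, with \<open>p\<close> collecting the singular
  values that are at least \<open>\<sigma>\<^sub>k\<close> and \<open>q\<close> the rest (\<open>spectral_splitting\<close>).  On \<open>q\<close> the map \<open>L\<close> expands
  by at most \<open>\<sigma>\<^bsub>k+1\<^esub>\<close> and \<open>\<parallel>q\<parallel> \<le> \<parallel>y\<parallel>\<close>, which yields the first summand of the bound.  On \<open>p\<close>
  it expands by at least \<open>\<sigma>\<^sub>k\<close>, so \<open>\<parallel>p\<parallel> \<le> \<parallel>L p\<parallel> / \<sigma>\<^sub>k\<close> and, as \<open>\<epsilon> \<ge> 0\<close>,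
  \<open>\<parallel>H p\<parallel>\<^sup>2 \<le> (\<tau> + \<epsilon> / \<sigma>\<^sub>k\<^sup>2) \<parallel>L p\<parallel>\<^sup>2\<close>; moreover \<open>\<parallel>L p\<parallel> \<le> \<parallel>L y\<parallel> = \<parallel>(L - Lhat) x\<parallel>\<close>, because \<open>L\<close> maps
  the two parts to orthogonal vectors.  This yields the second summand.

  The remaining work is the spectral theorem for self-adjoint maps, and the translation of the
  multiset of singular values and of the rank into statements about an eigenbasis of the Gram
  matrix.
\<close>

section \<open>Orthonormal eigenbases of self-adjoint maps\<close>

text \<open>
  A unit vector of \<open>S\<close> that maximizes the quadratic form \<open>x \<bullet> f x\<close> is an eigenvector, by
  the first-order condition; it exists by compactness.  Stating this for an invariant subspace lets
  the spectral theorem apply it to an orthogonal complement.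
\<close>

lemma rayleigh_eigenvector:
  fixes f :: "'a::euclidean_space \<Rightarrow> 'a"
  assumes lin: "linear f" and sa: "\<And>x y. f x \<bullet> y = x \<bullet> f y"
    and S: "subspace S" and inv: "\<And>x. x \<in> S \<Longrightarrow> f x \<in> S"
    and ne: "z \<in> S" "z \<noteq> 0"
  obtains u where "u \<in> S" "norm u = 1" "f u = (u \<bullet> f u) *\<^sub>R u"
proof -
  let ?K = "S \<inter> sphere 0 1"
  have "compact ?K"
    using S by (intro closed_Int_compact closed_subspace) auto
  moreover have "z /\<^sub>R norm z \<in> ?K"
    using ne S by (auto simp: subspace_scale)
  moreover have "continuous_on ?K (\<lambda>x. x \<bullet> f x)"
    using lin by (intro continuous_intros linear_continuous_on) (simp add: linear_conv_bounded_linear)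
  ultimately obtain u where u: "u \<in> ?K" and max: "\<And>y. y \<in> ?K \<Longrightarrow> y \<bullet> f y \<le> u \<bullet> f u"
    using continuous_attains_sup[of ?K "\<lambda>x. x \<bullet> f x"] by blast
  define \<mu> where "\<mu> = u \<bullet> f u"
  have uS: "u \<in> S" and nu: "norm u = 1"
    using u by auto
  have uu: "u \<bullet> u = 1"
    using nu by (simp add: norm_eq_1)
  have bound: "x \<bullet> f x \<le> \<mu> * (x \<bullet> x)" if "x \<in> S" for x
  proof (cases "x = 0")
    case False
    have "x /\<^sub>R norm x \<in> ?K"
      using that False S by (auto simp: subspace_scale)
    from max[OF this] have "(x \<bullet> f x) / (norm x)\<^sup>2 \<le> \<mu>"
      using lin by (simp add: \<mu>_def linear_cmul power2_eq_square divide_inverse mult_ac)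
    then show ?thesis
      using False by (simp add: divide_le_eq power2_norm_eq_inner)
  qed simp
  define w where "w = f u - \<mu> *\<^sub>R u"
  define c where "c = w \<bullet> f w - \<mu> * (w \<bullet> w)"
  have wS: "w \<in> S"
    unfolding w_def using S uS inv by (intro subspace_diff subspace_scale) auto
  \<comment> \<open>The defect \<open>\<mu> * (x \<bullet> x) - x \<bullet> f x\<close> vanishes at \<open>u\<close> and is nonnegative along
      \<open>u + t w\<close>, so its derivative at \<open>t = 0\<close>, which is \<open>- 2 * (w \<bullet> w)\<close>, must vanish.\<close>
  have quad: "2 * t * (w \<bullet> w) + t\<^sup>2 * c \<le> 0" for t
  proof -
    have "u + t *\<^sub>R w \<in> S"
      using S uS wS by (intro subspace_add subspace_scale)
    note bound[OF this]
    moreover have "f (u + t *\<^sub>R w) = f u + t *\<^sub>R f w"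
      using lin by (simp add: linear_add linear_cmul)
    moreover have "u \<bullet> f w = w \<bullet> f u"
      using sa[of u w] by (simp add: inner_commute)
    ultimately have "\<mu> + 2 * t * (w \<bullet> f u) + t\<^sup>2 * (w \<bullet> f w)
        \<le> \<mu> * (1 + 2 * t * (u \<bullet> w) + t\<^sup>2 * (w \<bullet> w))"
      using uu by (simp add: inner_add_left inner_add_right inner_commute[of w u]
          power2_eq_square algebra_simps flip: \<mu>_def)
    moreover have "w \<bullet> f u = w \<bullet> w + \<mu> * (u \<bullet> w)"
      by (simp add: inner_commute[of u w] flip: inner_scaleR_right inner_add_right) (simp add: w_def)
    ultimately show ?thesis
      by (simp add: c_def algebra_simps)
  qed
  have "w \<bullet> w \<le> 0"
  proof (rule ccontr)
    assume "\<not> w \<bullet> w \<le> 0"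
    define a where "a = w \<bullet> w"
    have a: "a > 0"
      using \<open>\<not> w \<bullet> w \<le> 0\<close> unfolding a_def by linarith
    \<comment> \<open>so small a step that the linear term dominates the quadratic one\<close>
    define t where "t = a / (\<bar>c\<bar> + 1)"
    have t: "t > 0"
      using a by (simp add: t_def)
    have "t * (\<bar>c\<bar> + 1) = a"
      by (simp add: t_def)
    then have "t * \<bar>c\<bar> < a * 2"
      using a t by (simp add: distrib_left)
    moreover have "- (t * \<bar>c\<bar>) \<le> t * c"
      using t by (simp add: abs_if)
    ultimately have "0 < t * (2 * a + t * c)"
      using t by (intro mult_pos_pos) auto
    with quad[of t] show False
      by (simp add: a_def power2_eq_square algebra_simps)
  qed
  then have "f u = \<mu> *\<^sub>R u"
    by (metis w_def inner_gt_zero_iff not_le eq_iff_diff_eq_0)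
  then show ?thesis
    unfolding \<mu>_def by (rule that[OF uS nu])
qed

text \<open>
  The eigenvalue belonging to a unit eigenvector \<open>b\<close> is \<open>b \<bullet> f b\<close>, so a set suffices to describe an
  eigenbasis together with its eigenvalues.
\<close>

locale orthonormal_eigenbasis =
  fixes f :: "'a::euclidean_space \<Rightarrow> 'a" and B :: "'a set"
  assumes lin: "linear f"
    and orth: "pairwise orthogonal B"
    and unit: "\<And>b. b \<in> B \<Longrightarrow> norm b = 1"
    and eigen: "\<And>b. b \<in> B \<Longrightarrow> f b = (b \<bullet> f b) *\<^sub>R b"
    and spanning: "span B = UNIV"

text \<open>
  An orthonormal set of eigenvectors of maximal size spans: its orthogonal complement is
  invariant, so if it were nonzero it would contain one more unit eigenvector.
\<close>

theorem ex_orthonormal_eigenbasis: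
  fixes f :: "'a::euclidean_space \<Rightarrow> 'a"
  assumes lin: "linear f" and sa: "\<And>x y. f x \<bullet> y = x \<bullet> f y"
  shows "\<exists>B. orthonormal_eigenbasis f B"
proof -
  define P where "P B \<longleftrightarrow> pairwise orthogonal B \<and> (\<forall>b\<in>B. norm b = 1 \<and> f b = (b \<bullet> f b) *\<^sub>R b)" for B
  have indep: "independent B" if "P B" for B
    using that unfolding P_def by (intro pairwise_orthogonal_independent) auto
  have "P {}"
    by (simp add: P_def)
  moreover have "\<forall>B. P B \<longrightarrow> card B \<le> DIM('a)"
    using indep independent_bound_general[where 'a='a] dim_subset_UNIV[where 'a='a]
    by (meson order_trans)
  ultimately have "\<exists>B. P B \<and> (\<forall>B'. P B' \<longrightarrow> card B' \<le> card B)"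
    by (intro Lattices_Big.ex_has_greatest_nat[of P "{}" card "Suc DIM('a)"]) auto
  then obtain B where B: "P B" and max: "\<And>B'. P B' \<Longrightarrow> card B' \<le> card B"
    by blast
  have "span B = UNIV"
  proof (rule ccontr)
    assume "span B \<noteq> UNIV"
    then have sub: "span B \<subset> span UNIV"
      by auto
    obtain z where z: "z \<noteq> 0" "\<And>y. y \<in> span B \<Longrightarrow> orthogonal z y"
      by (rule orthogonal_to_subspace_exists_gen[OF sub]) metis
    define S where "S = {x. \<forall>b\<in>B. x \<bullet> b = 0}"
    have "subspace S"
      by (auto simp: S_def subspace_def inner_add_left)
    moreover have "f x \<in> S" if "x \<in> S" for x
      unfolding S_def
    proof safe
      fix b assume "b \<in> B"
      then have "f b = (b \<bullet> f b) *\<^sub>R b"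
        using B by (simp add: P_def)
      then have "x \<bullet> f b = (b \<bullet> f b) * (x \<bullet> b)"
        by (metis inner_scaleR_right)
      then show "f x \<bullet> b = 0"
        using that \<open>b \<in> B\<close> by (simp add: sa S_def)
    qed
    moreover have "z \<in> S"
      using z by (auto simp: S_def orthogonal_def span_base)
    ultimately obtain u where u: "u \<in> S" "norm u = 1" "f u = (u \<bullet> f u) *\<^sub>R u"
      using rayleigh_eigenvector[OF lin sa] z(1) by metis
    have "u \<notin> B"
      using u by (auto simp: S_def norm_eq_1)
    have "P (insert u B)"
      using B u unfolding P_def
      by (auto simp: pairwise_insert S_def orthogonal_def inner_commute)
    from max[OF this] show False
      using \<open>u \<notin> B\<close> indep[OF B] by (simp add: finiteI_independent)
  qed
  moreover have "norm b = 1" "f b = (b \<bullet> f b) *\<^sub>R b" if "b \<in> B" for b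
    using B that unfolding P_def by blast+
  moreover have "pairwise orthogonal B"
    using B by (simp only: P_def)
  ultimately have "orthonormal_eigenbasis f B"
    using lin by (intro orthonormal_eigenbasis.intro)
  then show ?thesis ..
qed

context orthonormal_eigenbasis
begin

abbreviation eigval :: "'a \<Rightarrow> real" where "eigval b \<equiv> b \<bullet> f b"

lemma independent_subset: "A \<subseteq> B \<Longrightarrow> independent A"
proof (rule pairwise_orthogonal_independent)
  assume A: "A \<subseteq> B"
  show "pairwise orthogonal A"
    using orth A by (rule pairwise_subset)
  show "0 \<notin> A"
    using A unit[of 0] by auto
qed

lemma finite_basis: "finite B"
  by (simp add: finiteI_independent independent_subset)

lemma inner_basis: "b \<in> B \<Longrightarrow> b' \<in> B \<Longrightarrow> b \<bullet> b' = (if b = b' then 1 else 0)"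
  using orth unit by (auto simp: pairwise_def orthogonal_def norm_eq_1)

lemma expand: "(\<Sum>b\<in>B. (x \<bullet> b) *\<^sub>R b) = x"
  using orthonormal_basis_expand[OF orth unit _ finite_basis] spanning by auto

lemma parseval: "x \<bullet> y = (\<Sum>b\<in>B. (x \<bullet> b) * (y \<bullet> b))"
proof -
  have "x \<bullet> y = (\<Sum>b\<in>B. (x \<bullet> b) *\<^sub>R b) \<bullet> y"
    by (simp only: expand)
  then show ?thesis
    by (simp only: inner_sum_left inner_scaleR_left inner_commute[of y])
qed

lemma inner_image: "b \<in> B \<Longrightarrow> f x \<bullet> b = eigval b * (x \<bullet> b)"
proof -
  assume b: "b \<in> B"
  have "f x \<bullet> b = (\<Sum>b'\<in>B. (x \<bullet> b') * (f b' \<bullet> b))"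
    using lin by (subst expand[of x, symmetric])
      (simp add: linear_sum linear_cmul inner_sum_left)
  also have "\<dots> = (\<Sum>b'\<in>B. if b' = b then eigval b * (x \<bullet> b) else 0)"
  proof (rule sum.cong)
    fix b' assume b': "b' \<in> B"
    have "f b' \<bullet> b = eigval b' * (b' \<bullet> b)"
      by (subst eigen[OF b']) simp
    then show "(x \<bullet> b') * (f b' \<bullet> b) = (if b' = b then eigval b * (x \<bullet> b) else 0)"
      using b b' by (simp add: inner_basis)
  qed simp
  also have "\<dots> = eigval b * (x \<bullet> b)"
    using b finite_basis by simp
  finally show ?thesis .
qed

lemma quadratic_form: "x \<bullet> f x = (\<Sum>b\<in>B. eigval b * (x \<bullet> b)\<^sup>2)"
  by (subst parseval) (auto intro!: sum.cong simp: inner_image power2_eq_square)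

lemma eqI_basis: "(\<And>b. b \<in> B \<Longrightarrow> x \<bullet> b = y \<bullet> b) \<Longrightarrow> x = y"
  by (metis (mono_tags, lifting) expand sum.cong)

text \<open>
  Comparing coordinates, \<open>v\<close> is an eigenvector exactly if only basis vectors with one common
  eigenvalue occur in it; the sets of eigenvalues and the eigenspaces can be read off from this.
\<close>

lemma eigenvector_iff:
  "f v = c *\<^sub>R v \<longleftrightarrow> (\<forall>b\<in>B. v \<bullet> b \<noteq> 0 \<longrightarrow> eigval b = c)"
proof
  assume "f v = c *\<^sub>R v"
  then show "\<forall>b\<in>B. v \<bullet> b \<noteq> 0 \<longrightarrow> eigval b = c"
    using inner_image[of _ v] by auto
next
  assume *: "\<forall>b\<in>B. v \<bullet> b \<noteq> 0 \<longrightarrow> eigval b = c"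
  show "f v = c *\<^sub>R v"
    by (rule eqI_basis) (use * inner_image[of _ v] in auto)
qed

lemma eigenvalues: "{c. \<exists>v. v \<noteq> 0 \<and> f v = c *\<^sub>R v} = eigval ` B"
proof safe
  fix c v assume v: "v \<noteq> 0" "f v = c *\<^sub>R v"
  obtain b where "b \<in> B" "v \<bullet> b \<noteq> 0"
    using v(1) eqI_basis[of v 0] by auto
  with v show "c \<in> eigval ` B"
    using eigenvector_iff[of v c] by auto
next
  fix b assume "b \<in> B"
  then show "\<exists>v. v \<noteq> 0 \<and> f v = eigval b *\<^sub>R v"
    using eigen[of b] unit[of b] by (intro exI[of _ b]) auto
qed

lemma eigenspace: "{v. f v = c *\<^sub>R v} = span {b \<in> B. eigval b = c}"
proof (intro subset_antisym subsetI)
  fix v assume "v \<in> {v. f v = c *\<^sub>R v}"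
  then have *: "\<forall>b\<in>B. v \<bullet> b \<noteq> 0 \<longrightarrow> eigval b = c"
    by (simp add: eigenvector_iff)
  have "(\<Sum>b\<in>B. (v \<bullet> b) *\<^sub>R b) \<in> span {b \<in> B. eigval b = c}"
  proof (rule span_sum)
    fix b assume "b \<in> B"
    then show "(v \<bullet> b) *\<^sub>R b \<in> span {b \<in> B. eigval b = c}"
      using * by (cases "v \<bullet> b = 0") (auto intro: span_mul span_base span_zero)
  qed
  then show "v \<in> span {b \<in> B. eigval b = c}"
    by (simp add: expand)
next
  fix v assume "v \<in> span {b \<in> B. eigval b = c}"
  moreover have "subspace {v. f v = c *\<^sub>R v}"
    using lin by (auto simp: subspace_def linear_0 linear_add linear_cmul scaleR_add_right)
  moreover have "{b \<in> B. eigval b = c} \<subseteq> {v. f v = c *\<^sub>R v}"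
    using eigen by auto
  ultimately show "v \<in> {v. f v = c *\<^sub>R v}"
    using span_minimal by blast
qed

lemma dim_eigenspace: "dim {v. f v = c *\<^sub>R v} = card {b \<in> B. eigval b = c}"
  by (simp add: eigenspace dim_eq_card_independent independent_subset)

definition proj :: "'a set \<Rightarrow> 'a \<Rightarrow> 'a" where
  "proj A x = (\<Sum>b\<in>A. (x \<bullet> b) *\<^sub>R b)"

lemma inner_proj: "A \<subseteq> B \<Longrightarrow> b \<in> B \<Longrightarrow> proj A x \<bullet> b = (if b \<in> A then x \<bullet> b else 0)"
proof -
  assume A: "A \<subseteq> B" and b: "b \<in> B"
  have "proj A x \<bullet> b = (\<Sum>b'\<in>A. (x \<bullet> b') * (b' \<bullet> b))"
    by (simp add: proj_def inner_sum_left)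
  also have "\<dots> = (\<Sum>b'\<in>A. if b' = b then x \<bullet> b else 0)"
    using A b by (intro sum.cong) (auto simp: inner_basis)
  also have "\<dots> = (if b \<in> A then x \<bullet> b else 0)"
    using A finite_basis by (simp add: finite_subset)
  finally show ?thesis .
qed

end

section \<open>Spectral description of a matrix\<close>

lemma inner_transpose_mult: "x \<bullet> (transpose A *v y) = (A *v x) \<bullet> y" for A :: "real^'n^'m"
  by (metis dot_lmul_matrix inner_commute transpose_matrix_vector)

lemma inner_gram: "x \<bullet> ((transpose A ** A) *v y) = (A *v x) \<bullet> (A *v y)" for A :: "real^'n^'m"
  by (simp add: inner_transpose_mult flip: matrix_vector_mul_assoc del: transpose_matrix_vector)

lemma gram_eigenbasis:
  fixes A :: "real^'n^'m"
  obtains B where "orthonormal_eigenbasis ((*v) (transpose A ** A)) B"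
proof -
  have "((transpose A ** A) *v x) \<bullet> y = x \<bullet> ((transpose A ** A) *v y)" for x y
    unfolding inner_gram by (subst inner_commute) (simp only: inner_gram inner_commute)
  from ex_orthonormal_eigenbasis[OF matrix_vector_mul_linear this] show ?thesis
    using that by (elim exE)
qed

lemma quadratic_form_le_max_eigenvalue:
  fixes A :: "real^'n^'n"
  assumes sym: "\<And>x y. (A *v x) \<bullet> y = x \<bullet> (A *v y)"
  shows "x \<bullet> (A *v x) \<le> max_eigenvalue A * (x \<bullet> x)"
proof -
  obtain B where "orthonormal_eigenbasis ((*v) A) B"
    using ex_orthonormal_eigenbasis[OF matrix_vector_mul_linear sym] by (elim exE)
  then interpret orthonormal_eigenbasis "(*v) A" B .
  have ev: "max_eigenvalue A = Max (eigval ` B)"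
    using eigenvalues by (simp add: max_eigenvalue_def is_eigenvalue_def)
  have "x \<bullet> (A *v x) \<le> (\<Sum>b\<in>B. max_eigenvalue A * (x \<bullet> b)\<^sup>2)"
    unfolding quadratic_form[of x] ev
    using finite_basis by (intro sum_mono mult_right_mono) auto
  also have "\<dots> = max_eigenvalue A * (x \<bullet> x)"
    by (simp add: parseval[of x x] power2_eq_square sum_distrib_left)
  finally show ?thesis .
qed

text \<open>
  The quadratic form of \<open>H\<^sup>T H - \<tau> L\<^sup>T L\<close> is bounded by its largest eigenvalue.  This is how
  an estimate for \<open>L\<close> is transferred to \<open>H\<close>.
\<close>

lemma norm_mult_le_eps:
  fixes H :: "real^'n^'k" and L :: "real^'n^'m"
  shows "(norm (H *v x))\<^sup>2 \<le> \<tau> * (norm (L *v x))\<^sup>2 + eps H L \<tau> * (norm x)\<^sup>2"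
proof -
  let ?A = "transpose H ** H - \<tau> *\<^sub>R (transpose L ** L)"
  have form: "x \<bullet> (?A *v y) = (H *v x) \<bullet> (H *v y) - \<tau> * ((L *v x) \<bullet> (L *v y))" for x y
    by (simp add: matrix_vector_mult_diff_rdistrib inner_diff_right inner_gram
        flip: scaleR_matrix_vector_assoc)
  have "(?A *v x) \<bullet> y = x \<bullet> (?A *v y)" for x y
    by (subst inner_commute) (simp only: form inner_commute)
  from quadratic_form_le_max_eigenvalue[OF this, of x] show ?thesis
    by (simp add: form eps_def power2_norm_eq_inner)
qed

lemma image_mset_eq_sum_replicate:
  fixes l :: "'a \<Rightarrow> 'b" and g :: "'b \<Rightarrow> 'c"
  assumes "finite B"
  shows "image_mset (\<lambda>b. g (l b)) (mset_set B) =
    (\<Sum>c\<in>l ` B. replicate_mset (card {b \<in> B. l b = c}) (g c))"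
proof -
  have "image_mset h (mset_set A) = (\<Sum>b\<in>A. {#h b#})" if "finite A" for h :: "'a \<Rightarrow> 'c" and A
    using that by (induction A) auto
  note * = this
  have "image_mset (\<lambda>b. g (l b)) (mset_set B) =
      (\<Sum>c\<in>l ` B. \<Sum>b\<in>{b \<in> B. l b = c}. {#g (l b)#})"
    unfolding *[OF assms] by (rule sum.image_gen[OF assms])
  also have "\<dots> = (\<Sum>c\<in>l ` B. replicate_mset (card {b \<in> B. l b = c}) (g c))"
  proof (rule sum.cong)
    fix c
    have "(\<Sum>b\<in>{b \<in> B. l b = c}. {#g (l b)#}) = image_mset (\<lambda>b. g c) (mset_set {b \<in> B. l b = c})"
      using assms by (subst *) (auto intro: sum.cong)
    then show "(\<Sum>b\<in>{b \<in> B. l b = c}. {#g (l b)#}) = replicate_mset (card {b \<in> B. l b = c}) (g c)"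
      by (simp add: image_mset_const_eq)
  qed simp
  finally show ?thesis .
qed

text \<open>
  The elements of \<open>B\<close> are right singular vectors of \<open>A\<close>, and the singular value that belongs to
  \<open>b\<close> is \<open>norm (A *v b)\<close>.
\<close>

locale gram_basis = orthonormal_eigenbasis "(*v) (transpose A ** A)" B
  for A :: "real^'n^'m" and B
begin

lemma eigval_eq: "eigval b = (norm (A *v b))\<^sup>2"
  by (simp add: inner_gram power2_norm_eq_inner)

lemma singular_values_eq: "singular_values A = image_mset (\<lambda>b. norm (A *v b)) (mset_set B)"
proof -
  have "singular_values A =
      (\<Sum>c\<in>eigval ` B. replicate_mset (card {b \<in> B. eigval b = c}) (sqrt c))"
    unfolding singular_values_def Let_def is_eigenvalue_def eigenvalues dim_eigenspace ..
  also have "\<dots> = image_mset (\<lambda>b. sqrt (eigval b)) (mset_set B)"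
    by (rule image_mset_eq_sum_replicate[OF finite_basis, symmetric])
  finally show ?thesis
    by (simp add: eigval_eq)
qed

lemma norm_mult: "(norm (A *v x))\<^sup>2 = (\<Sum>b\<in>B. (norm (A *v b))\<^sup>2 * (x \<bullet> b)\<^sup>2)"
  using quadratic_form[of x] by (simp add: eigval_eq power2_norm_eq_inner inner_gram)

text \<open>
  The images of the right singular vectors are pairwise orthogonal, so the nonzero ones form a
  basis of the range.
\<close>

lemma rank_eq: "rank A = card {b \<in> B. A *v b \<noteq> 0}"
proof -
  let ?R = "{b \<in> B. A *v b \<noteq> 0}"
  have orthA: "(A *v b) \<bullet> (A *v b') = 0" if "b \<in> B" "b' \<in> B" "b \<noteq> b'" for b b'
  proof -
    have "(A *v b) \<bullet> (A *v b') = b \<bullet> ((transpose A ** A) *v b')"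
      by (simp only: inner_gram)
    also have "\<dots> = eigval b' * (b \<bullet> b')"
      by (metis eigen[OF that(2)] inner_scaleR_right)
    finally show ?thesis
      using that by (simp add: inner_basis)
  qed
  have inj: "inj_on ((*v) A) ?R"
    using orthA by (auto simp: inj_on_def) (metis inner_eq_zero_iff)
  have "independent ((*v) A ` ?R)"
    using orthA by (intro pairwise_orthogonal_independent)
      (auto simp: pairwise_def orthogonal_def)
  moreover have "span ((*v) A ` ?R) = range ((*v) A)"
  proof -
    have "range ((*v) A) = span ((*v) A ` B)"
      using linear_span_image[of "(*v) A" B] spanning by simp
    also have "\<dots> = span (insert 0 ((*v) A ` B))"
      by simp
    also have "insert 0 ((*v) A ` B) = insert 0 ((*v) A ` ?R)"
      by auto
    finally show ?thesis
      by simp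
  qed
  ultimately have "dim (range ((*v) A)) = card ((*v) A ` ?R)"
    using dim_eq_card_independent[of "(*v) A ` ?R"] dim_span[of "(*v) A ` ?R"] by simp
  then show ?thesis
    by (simp add: rank_dim_range card_image[OF inj])
qed

end

section \<open>Positions in a decreasingly sorted multiset\<close>

text \<open>
  In a decreasing list the positive entries form an initial segment, so their number decides the
  sign at each position.
\<close>

lemma nth_pos_iff_less_count_pos:
  fixes M :: "real multiset"
  defines "xs \<equiv> rev (sorted_list_of_multiset M)"
  assumes j: "j < length xs"
  shows "0 < xs ! j \<longleftrightarrow> j < size (filter_mset (\<lambda>x. 0 < x) M)"
proof -
  have anti: "xs ! q \<le> xs ! p" if "p \<le> q" "q < length xs" for p q
    using sorted_rev_nth_mono[of xs p q] that by (simp add: xs_def)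
  let ?I = "{i. i < length xs \<and> 0 < xs ! i}"
  have "mset xs = M"
    by (simp add: xs_def)
  then have size: "size (filter_mset (\<lambda>x. 0 < x) M) = card ?I"
    by (metis length_filter_conv_card mset_filter size_mset)
  show ?thesis
  proof
    assume pos: "0 < xs ! j"
    have "{..j} \<subseteq> ?I"
    proof safe
      fix i assume "i \<le> j"
      with anti[of i j] j pos show "i < length xs" "0 < xs ! i"
        by auto
    qed
    then have "card {..j} \<le> card ?I"
      by (intro card_mono) auto
    then show "j < size (filter_mset (\<lambda>x. 0 < x) M)"
      by (simp add: size)
  next
    assume less: "j < size (filter_mset (\<lambda>x. 0 < x) M)"
    show "0 < xs ! j"
    proof (rule ccontr)
      assume nonpos: "\<not> 0 < xs ! j"
      have "?I \<subseteq> {..<j}"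
      proof safe
        fix i assume "i < length xs" "0 < xs ! i"
        with anti[of j i] nonpos show "i < j"
          by (cases "j \<le> i") auto
      qed
      then have "card ?I \<le> j"
        using card_mono[of "{..<j}" ?I] by simp
      with less show False
        by (simp add: size)
    qed
  qed
qed

text \<open>
  An element strictly below the one at position \<open>j\<close> can only occur after position \<open>j\<close>, hence is
  bounded by its successor.  The strict inequality takes care of repeated elements.
\<close>

lemma le_next_of_less_nth:
  fixes M :: "real multiset"
  defines "xs \<equiv> rev (sorted_list_of_multiset M)"
  assumes "x \<in># M" "x < xs ! j" "j < length xs"
  shows "Suc j < length xs \<and> x \<le> xs ! Suc j"
proof -
  have anti: "xs ! q \<le> xs ! p" if "p \<le> q" "q < length xs" for p q
    using sorted_rev_nth_mono[of xs p q] that by (simp add: xs_def)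
  have "x \<in> set xs"
    using assms by (simp add: xs_def)
  then obtain i where i: "i < length xs" "x = xs ! i"
    by (metis in_set_conv_nth)
  have "\<not> i \<le> j"
    using anti[of i j] assms i by auto
  then show ?thesis
    using anti[of "Suc j" i] i by auto
qed

section \<open>Splitting a vector at the kth singular value\<close>

context gram_basis
begin

lemma length_singular_values:
  "length (rev (sorted_list_of_multiset (singular_values A))) = card B"
proof -
  have "length (rev (sorted_list_of_multiset (singular_values A))) =
      size (mset (sorted_list_of_multiset (singular_values A)))"
    by (simp only: size_mset length_rev)
  then show ?thesis
    by (simp add: singular_values_eq)
qed

lemma rank_eq_positive: "rank A = size (filter_mset (\<lambda>x. 0 < x) (singular_values A))"
  by (simp add: rank_eq singular_values_eq filter_mset_image_mset finite_basis)

lemma rank_le_card: "rank A \<le> card B"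
  unfolding rank_eq by (intro card_mono finite_basis) auto

lemma singular_value_pos:
  assumes "1 \<le> k" "k \<le> rank A"
  shows "0 < singular_value A k"
proof -
  have k: "k - 1 < rank A"
    using assms by simp
  then have "k - 1 < length (rev (sorted_list_of_multiset (singular_values A)))"
    unfolding length_singular_values using rank_le_card by (rule less_le_trans)
  from nth_pos_iff_less_count_pos[OF this] k show ?thesis
    by (simp only: singular_value_def rank_eq_positive)
qed

text \<open>
  Thus cutting by value instead of by index loses nothing: all singular values below
  \<open>\<sigma>\<^sub>k\<close> are bounded by \<open>\<sigma>\<^bsub>k+1\<^esub>\<close>, even if \<open>\<sigma>\<^sub>k = \<sigma>\<^bsub>k+1\<^esub>\<close>.  At \<open>k = rank A\<close> the bound
  is zero because there are exactly \<open>rank A\<close> positive singular values.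
\<close>

lemma singular_value_gap:
  assumes "1 \<le> k" "k \<le> rank A" "b \<in> B" "norm (A *v b) < singular_value A k"
  shows "norm (A *v b) \<le> (if k = rank A then 0 else singular_value A (k + 1))"
proof -
  let ?xs = "rev (sorted_list_of_multiset (singular_values A))"
  have k: "k - 1 < length ?xs"
    using assms rank_le_card by (simp add: length_singular_values del: length_rev)
  have "norm (A *v b) \<in># singular_values A"
    using assms finite_basis by (simp add: singular_values_eq)
  from le_next_of_less_nth[OF this _ k] assms
  have nxt: "k < length ?xs" "norm (A *v b) \<le> ?xs ! k"
    by (auto simp: singular_value_def)
  have zero: "?xs ! k \<le> 0" if "k = rank A"
    using nth_pos_iff_less_count_pos[OF nxt(1)] that rank_eq_positive by linarith
  show ?thesis
  proof (cases "k = rank A")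
    case True
    from nxt(2) zero[OF True] have "norm (A *v b) \<le> 0"
      by (rule order_trans)
    then show ?thesis
      by (simp add: True)
  next
    case False
    with nxt(2) show ?thesis
      by (simp add: singular_value_def)
  qed
qed

text \<open>
  The part \<open>p\<close> is the projection of \<open>y\<close> onto the right singular vectors whose singular value is at
  least \<open>\<sigma>\<^sub>k\<close>.  All claims compare, coordinate by coordinate, the weighted sums of squares in
  \<open>norm_mult\<close> and Parseval's identity.
\<close>

lemma spectral_splitting:
  assumes "1 \<le> k" "k \<le> rank A"
  defines "s \<equiv> (if k = rank A then 0 else singular_value A (k + 1))"
  obtains p q where "y = p + q"
    and "singular_value A k * norm p \<le> norm (A *v p)" "norm (A *v p) \<le> norm (A *v y)"
    and "norm q \<le> norm y" "norm (A *v q) \<le> s * norm q"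
proof -
  let ?s = "singular_value A k"
  have s: "0 < ?s"
    using singular_value_pos assms by simp
  define T where "T = {b \<in> B. ?s \<le> norm (A *v b)}"
  define p where "p = proj T y"
  define q where "q = y - p"
  have p: "p \<bullet> b = (if b \<in> T then y \<bullet> b else 0)" if "b \<in> B" for b
    using that unfolding p_def by (intro inner_proj) (auto simp: T_def)
  have q: "q \<bullet> b = (if b \<in> T then 0 else y \<bullet> b)" if "b \<in> B" for b
    using p[OF that] by (simp add: q_def inner_diff_left)
  have norm2: "(norm x)\<^sup>2 = (\<Sum>b\<in>B. (x \<bullet> b)\<^sup>2)" for x
    unfolding power2_norm_eq_inner parseval[of x x] by (simp add: power2_eq_square)
  show thesis
  proof
    show "y = p + q"
      by (simp add: q_def)
    have "(?s * norm p)\<^sup>2 \<le> (norm (A *v p))\<^sup>2"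
      unfolding power_mult_distrib norm2 norm_mult[of p] sum_distrib_left
      using s by (intro sum_mono) (auto simp: p T_def intro!: mult_right_mono power_mono)
    then show "?s * norm p \<le> norm (A *v p)"
      by (rule power2_le_imp_le) simp
    have "(norm (A *v p))\<^sup>2 \<le> (norm (A *v y))\<^sup>2"
      unfolding norm_mult[of p] norm_mult[of y] by (intro sum_mono) (auto simp: p)
    then show "norm (A *v p) \<le> norm (A *v y)"
      by (rule power2_le_imp_le) simp
    have "(norm q)\<^sup>2 \<le> (norm y)\<^sup>2"
      unfolding norm2 by (intro sum_mono) (auto simp: q)
    then show "norm q \<le> norm y"
      by (rule power2_le_imp_le) simp
    have low: "norm (A *v b) \<le> s" if "b \<in> B" "b \<notin> T" for b
      using singular_value_gap[of k b] that assms by (auto simp: T_def s_def)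
    have "(norm (A *v q))\<^sup>2 \<le> (s * norm q)\<^sup>2"
      unfolding power_mult_distrib norm2 norm_mult[of q] sum_distrib_left
      using low by (intro sum_mono) (auto simp: q intro!: mult_right_mono power_mono)
    moreover have "0 \<le> s"
      using singular_value_pos[of "k + 1"] assms by (auto simp: s_def)
    ultimately show "norm (A *v q) \<le> s * norm q"
      by (auto intro: power2_le_imp_le)
  qed
qed

end

section \<open>The error bound\<close>

lemma norm_mult_le_spectral_norm: "norm (A *v x) \<le> spectral_norm A * norm x"
  for A :: "real^'n^'m"
  unfolding spectral_norm_def by (rule onorm) simp

lemma spectral_norm_leI: "(\<And>x. norm (A *v x) \<le> c * norm x) \<Longrightarrow> spectral_norm A \<le> c"
  for A :: "real^'n^'m"
  unfolding spectral_norm_def by (rule onorm_le)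

text \<open>
  The selection matrix with columns \<open>axis (idx i) 1\<close>, as a map on vectors.
\<close>

definition scatter :: "('r \<Rightarrow> 'n) \<Rightarrow> real^'r \<Rightarrow> real^'n" where
  "scatter idx z = (\<Sum>i\<in>UNIV. z $ i *\<^sub>R axis (idx i) 1)"

lemma norm_scatter:
  assumes "inj idx"
  shows "norm (scatter idx z) = norm z"
proof -
  have "(norm (scatter idx z))\<^sup>2 = (\<Sum>i\<in>UNIV. (norm (z $ i *\<^sub>R axis (idx i) (1::real)))\<^sup>2)"
    unfolding scatter_def using assms
    by (intro norm_sum_Pythagorean)
      (auto simp: pairwise_def orthogonal_def inner_axis_axis inj_eq)
  also have "\<dots> = (norm z)\<^sup>2"
    by (simp add: norm_axis_1 power2_norm_eq_inner inner_vec_def power2_eq_square[symmetric])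
  finally show ?thesis
    by simp
qed

lemma mult_scatter: "A *v scatter idx z = select_columns A idx *v z"
  for A :: "real^'n^'m"
proof -
  have "A *v scatter idx z = (\<Sum>i\<in>UNIV. z $ i *\<^sub>R column (idx i) A)"
    by (simp add: scatter_def linear_sum[OF matrix_vector_mul_linear]
        linear_cmul[OF matrix_vector_mul_linear] matrix_vector_mult_basis)
  then show ?thesis
    by (simp add: vec_eq_iff column_def select_columns_def matrix_vector_mult_def mult.commute)
qed

text \<open>
  The residual vector on the right is the same for every matrix \<open>A\<close>, which is what links the error
  of the high-fidelity estimate to that of the low-fidelity one.
\<close>

lemma error_eq_mult_residual:
  fixes A :: "real^'n^'m" and C :: "real^'n^'r"
  shows "(A - select_columns A idx ** C) *v x = A *v (x - scatter idx (C *v x))"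
  by (simp add: matrix_vector_mult_diff_rdistrib matrix_vector_mult_diff_distrib mult_scatter
      matrix_vector_mul_assoc)

lemma spectral_norm_error_le_rho:
  fixes H Hhat :: "real^'n^'k" and L Lhat :: "real^'n^'m" and C :: "real^'n^'r"
  assumes est: "corresponding_estimates H L C Hhat Lhat"
    and \<tau>: "0 \<le> \<tau>" and eps: "0 \<le> eps H L \<tau>" and k: "1 \<le> k" "k \<le> rank L"
  shows "spectral_norm (H - Hhat) \<le> rho H L C Lhat k \<tau>"
proof -
  obtain idx :: "'r \<Rightarrow> 'n" where idx: "inj idx"
    and Hhat: "Hhat = select_columns H idx ** C" and Lhat: "Lhat = select_columns L idx ** C"
    using est by (auto simp: corresponding_estimates_def)
  obtain B where "orthonormal_eigenbasis ((*v) (transpose L ** L)) B"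
    by (rule gram_eigenbasis)
  then interpret gram_basis L B
    by (simp add: gram_basis_def)
  define \<sigma> where "\<sigma> = singular_value L k"
  define \<sigma>' where "\<sigma>' = (if k = rank L then 0 else singular_value L (k + 1))"
  define e where "e = eps H L \<tau>"
  have \<sigma>: "0 < \<sigma>"
    using singular_value_pos[OF k] by (simp add: \<sigma>_def)
  show ?thesis
  proof (rule spectral_norm_leI)
    fix x
    define y where "y = x - scatter idx (C *v x)"
    have Hy: "(H - Hhat) *v x = H *v y" and Ly: "(L - Lhat) *v x = L *v y"
      by (simp_all add: Hhat Lhat error_eq_mult_residual y_def)
    obtain p q where y: "y = p + q"
      and p: "\<sigma> * norm p \<le> norm (L *v p)" "norm (L *v p) \<le> norm (L *v y)"
      and q: "norm q \<le> norm y" "norm (L *v q) \<le> \<sigma>' * norm q"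
      unfolding \<sigma>_def \<sigma>'_def using spectral_splitting[OF k] by blast

    \<comment> \<open>the part with small singular values\<close>
    have "norm y \<le> norm x + norm (C *v x)"
      unfolding y_def using norm_triangle_ineq4 by (metis norm_scatter[OF idx])
    then have norm_y: "norm y \<le> (1 + spectral_norm C) * norm x"
      using norm_mult_le_spectral_norm[of C x] by (simp add: algebra_simps)
    have "(norm (H *v q))\<^sup>2 \<le> \<tau> * (norm (L *v q))\<^sup>2 + e * (norm q)\<^sup>2"
      unfolding e_def by (rule norm_mult_le_eps)
    also have "\<dots> \<le> \<tau> * (\<sigma>' * norm q)\<^sup>2 + e * (norm q)\<^sup>2"
      using q \<tau> by (intro add_right_mono mult_left_mono power_mono) auto
    also have "\<dots> = (\<tau> * \<sigma>'\<^sup>2 + e) * (norm q)\<^sup>2"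
      by (simp add: algebra_simps power_mult_distrib)
    finally have "norm (H *v q) \<le> sqrt ((\<tau> * \<sigma>'\<^sup>2 + e) * (norm q)\<^sup>2)"
      by (rule real_le_rsqrt)
    also have "\<dots> = sqrt (\<tau> * \<sigma>'\<^sup>2 + e) * norm q"
      by (simp add: real_sqrt_mult)
    also have "\<dots> \<le> sqrt (\<tau> * \<sigma>'\<^sup>2 + e) * ((1 + spectral_norm C) * norm x)"
      using q norm_y \<tau> eps by (intro mult_left_mono) (auto simp: e_def)
    finally have Hq: "norm (H *v q) \<le> sqrt (\<tau> * \<sigma>'\<^sup>2 + e) * ((1 + spectral_norm C) * norm x)" .

    \<comment> \<open>the part with large singular values, where \<open>L\<close> can be inverted\<close>
    have "norm p \<le> norm (L *v p) / \<sigma>"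
      using p \<sigma> by (simp add: pos_le_divide_eq mult.commute)
    have "(norm (H *v p))\<^sup>2 \<le> \<tau> * (norm (L *v p))\<^sup>2 + e * (norm p)\<^sup>2"
      unfolding e_def by (rule norm_mult_le_eps)
    also have "\<dots> \<le> \<tau> * (norm (L *v p))\<^sup>2 + e * (norm (L *v p) / \<sigma>)\<^sup>2"
      using \<open>norm p \<le> norm (L *v p) / \<sigma>\<close> eps
      by (intro add_left_mono mult_left_mono power_mono) (auto simp: e_def)
    also have "\<dots> = (\<tau> + e * inverse (\<sigma>\<^sup>2)) * (norm (L *v p))\<^sup>2"
      by (simp add: algebra_simps power_divide divide_inverse power_inverse)
    finally have "norm (H *v p) \<le> sqrt ((\<tau> + e * inverse (\<sigma>\<^sup>2)) * (norm (L *v p))\<^sup>2)"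
      by (rule real_le_rsqrt)
    also have "\<dots> = sqrt (\<tau> + e * inverse (\<sigma>\<^sup>2)) * norm (L *v p)"
      by (simp add: real_sqrt_mult)
    also have "\<dots> \<le> sqrt (\<tau> + e * inverse (\<sigma>\<^sup>2)) * (spectral_norm (L - Lhat) * norm x)"
      using p(2) norm_mult_le_spectral_norm[of "L - Lhat" x] \<tau> eps
      unfolding Ly by (intro mult_left_mono) (auto simp: e_def)
    finally have Hp: "norm (H *v p) \<le>
        sqrt (\<tau> + e * inverse (\<sigma>\<^sup>2)) * (spectral_norm (L - Lhat) * norm x)" .

    have "norm ((H - Hhat) *v x) \<le> norm (H *v p) + norm (H *v q)"
      unfolding Hy y matrix_vector_right_distrib by (rule norm_triangle_ineq)
    also have "\<dots> \<le> rho H L C Lhat k \<tau> * norm x"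
      using add_mono[OF Hp Hq]
      by (simp add: rho_def Let_def algebra_simps flip: \<sigma>_def \<sigma>'_def e_def)
    finally show "norm ((H - Hhat) *v x) \<le> rho H L C Lhat k \<tau> * norm x" .
  qed
qed

theorem theorem1:
  fixes H Hhat :: "real^'N^'M"
    and L Lhat :: "real^'N^'m"
    and C :: "real^'N^'r"
  assumes "corresponding_estimates H L C Hhat Lhat"
  shows "ereal (spectral_norm (H - Hhat)) \<le>
    (INF (\<tau>, k) \<in> {(\<tau>, k). 0 \<le> \<tau> \<and> 0 \<le> eps H L \<tau> \<and> 1 \<le> k \<and> k \<le> rank L}.
       ereal (rho H L C Lhat k \<tau>))"
  using assms by (auto intro!: INF_greatest spectral_norm_error_le_rho)

end
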